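(* Let $S$ be a set and let $M = (m_{s,t})_{s,t\in S}$ be a Coxeter matrix. If all the coefficients of $M$ are finite, and are either odd or equal to $2$, then the lower central series of the associated Artin group $A_M$ stops at $\Gamma_2$.
   Context: For a group $G$, $\Gamma_1(G) = G$ and $\Gamma_{i}(G) = [G, \Gamma_{i-1}(G)]$ for $i \geq 2$. The lower central series of $G$ stops at $\Gamma_k$ if $k$ is the smallest integer $i\geq 1$ with $\Gamma_i(G) = \Gamma_{i+1}(G)$. A Coxeter matrix on $S$ is a symmetric matrix $(m_{s,t})_{s,t\in S}$ with coefficients in $\mathbb{N}\cup\{\infty\}$, with $m_{s,s}=1$ and $m_{s,t}\geq 2$ if $s\neq t$. The associated Artin group is $$A_M = \Big\langle S\ \Big|\ \underbrace{ststs\cdots}_{m_{s,t}} = \underbrace{tstst\cdots}_{m_{s,t}}\ \ (s,t\in S,\ m_{s,t}\neq\infty)\Big\rangle.$$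
   Formalization: The set S is assumed nonempty; for S empty the Artin group is trivial and its lower central series stops at Γ_1, so the claim fails in that case. *)

theory Defs
  imports "HOL-Algebra.Generated_Groups" "HOL-Library.Extended_Nat"
begin

section \<open>Lower central series\<close>

definition commutator_subgroup :: "('a, 'b) monoid_scheme \<Rightarrow> 'a set \<Rightarrow> 'a set \<Rightarrow> 'a set" where
  "commutator_subgroup G H K =
     generate G (\<Union>h\<in>H. \<Union>k\<in>K. {h \<otimes>\<^bsub>G\<^esub> k \<otimes>\<^bsub>G\<^esub> inv\<^bsub>G\<^esub> h \<otimes>\<^bsub>G\<^esub> inv\<^bsub>G\<^esub> k})"

text \<open>The series is indexed from 1; the value at 0 is a dummy.\<close>

fun lower_central :: "('a, 'b) monoid_scheme \<Rightarrow> nat \<Rightarrow> 'a set" where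
  "lower_central G 0 = carrier G"
| "lower_central G (Suc 0) = carrier G"
| "lower_central G (Suc (Suc i)) =
     commutator_subgroup G (carrier G) (lower_central G (Suc i))"

definition lower_central_stops_at :: "('a, 'b) monoid_scheme \<Rightarrow> nat \<Rightarrow> bool" where
  "lower_central_stops_at G k \<longleftrightarrow>
     1 \<le> k \<and> lower_central G k = lower_central G (k + 1) \<and>
     (\<forall>i. 1 \<le> i \<and> lower_central G i = lower_central G (i + 1) \<longrightarrow> k \<le> i)"

section \<open>Groups given by generators and relations\<close>

text \<open>A letter \<open>(s, True)\<close> stands for the generator \<open>s\<close> and \<open>(s, False)\<close> for its
  formal inverse. A pair \<open>(u, v)\<close> in \<open>R\<close> stands for the relation \<open>u = v\<close>.\<close>

type_synonym 'a gword = "('a \<times> bool) list"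

definition gwords :: "'a set \<Rightarrow> 'a gword set" where
  "gwords S = lists (S \<times> UNIV)"

text \<open>The smallest congruence on the monoid of words that contains the relations
  and identifies \<open>s s\<^sup>-\<^sup>1\<close> and \<open>s\<^sup>-\<^sup>1 s\<close> with the empty word.\<close>

inductive_set pres_rel :: "'a set \<Rightarrow> ('a gword \<times> 'a gword) set \<Rightarrow> ('a gword \<times> 'a gword) set"
  for S R where
  pres_refl: "u \<in> gwords S \<Longrightarrow> (u, u) \<in> pres_rel S R"
| pres_sym: "(u, v) \<in> pres_rel S R \<Longrightarrow> (v, u) \<in> pres_rel S R"
| pres_trans: "(u, v) \<in> pres_rel S R \<Longrightarrow> (v, w) \<in> pres_rel S R \<Longrightarrow> (u, w) \<in> pres_rel S R"
| pres_app: "(u, v) \<in> pres_rel S R \<Longrightarrow> (u', v') \<in> pres_rel S R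
     \<Longrightarrow> (u @ u', v @ v') \<in> pres_rel S R"
| pres_cancel: "s \<in> S \<Longrightarrow> ([(s, b), (s, \<not> b)], []) \<in> pres_rel S R"
| pres_rels: "(u, v) \<in> R \<Longrightarrow> u \<in> gwords S \<Longrightarrow> v \<in> gwords S \<Longrightarrow> (u, v) \<in> pres_rel S R"

definition presented_group :: "'a set \<Rightarrow> ('a gword \<times> 'a gword) set \<Rightarrow> 'a gword set monoid" where
  "presented_group S R =
     \<lparr>carrier = gwords S // pres_rel S R,
      monoid.mult = (\<lambda>A B. \<Union>u\<in>A. \<Union>v\<in>B. pres_rel S R `` {u @ v}),
      one = pres_rel S R `` {[]}\<rparr>"

lemma pres_rel_gwords:
  "(u, v) \<in> pres_rel S R \<Longrightarrow> u \<in> gwords S \<and> v \<in> gwords S"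
  by (induction rule: pres_rel.induct) (auto simp: gwords_def)

lemma equiv_pres_rel: "equiv (gwords S) (pres_rel S R)"
  by (rule equivI)
     (auto intro!: refl_onI symI transI dest: pres_rel_gwords
       intro: pres_refl pres_sym pres_trans)

lemma presented_group_mult:
  assumes "u \<in> gwords S" "v \<in> gwords S"
  shows "pres_rel S R `` {u} \<otimes>\<^bsub>presented_group S R\<^esub> pres_rel S R `` {v}
       = pres_rel S R `` {u @ v}"
proof -
  have c: "congruent2 (pres_rel S R) (pres_rel S R) (\<lambda>u v. pres_rel S R `` {u @ v})"
    by (rule congruent2I')
       (meson equiv_class_eq_iff equiv_pres_rel pres_app pres_rel_gwords)
  show ?thesis
    using UN_equiv_class2[OF equiv_pres_rel equiv_pres_rel c assms]
    by (simp add: presented_group_def)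
qed

lemma presented_group_is_group: "group (presented_group S R)"
proof (rule groupI)
  let ?G = "presented_group S R" and ?r = "pres_rel S R"
  have carr: "carrier ?G = gwords S // ?r" and one: "\<one>\<^bsub>?G\<^esub> = ?r `` {[]}"
    by (auto simp: presented_group_def)
  have nil: "[] \<in> gwords S" and app: "\<And>u v. u \<in> gwords S \<Longrightarrow> v \<in> gwords S \<Longrightarrow> u @ v \<in> gwords S"
    by (auto simp: gwords_def)
  show "\<one>\<^bsub>?G\<^esub> \<in> carrier ?G"
    using nil by (simp add: carr one quotientI)
  fix x assume "x \<in> carrier ?G"
  then obtain u where u: "u \<in> gwords S" "x = ?r `` {u}"
    by (auto simp: carr elim: quotientE)
  show "\<one>\<^bsub>?G\<^esub> \<otimes>\<^bsub>?G\<^esub> x = x"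
    using presented_group_mult[OF nil u(1), of R] u by (simp add: one)
  have "\<exists>w\<in>gwords S. (w @ u, []) \<in> ?r"
    using u(1)
  proof (induction u)
    case Nil
    then show ?case using nil pres_refl by fastforce
  next
    case (Cons a u)
    obtain s b where a: "a = (s, b)" by (cases a)
    have s: "s \<in> S" and "u \<in> gwords S" using Cons.prems a by (auto simp: gwords_def)
    then obtain w where w: "w \<in> gwords S" "(w @ u, []) \<in> ?r" using Cons.IH by blast
    have "([(s, \<not> b), (s, b)], []) \<in> ?r" using pres_cancel[OF s, of "\<not> b"] by simp
    then have "([(s, \<not> b), (s, b)] @ u, [] @ u) \<in> ?r"
      using \<open>u \<in> gwords S\<close> by (intro pres_app pres_refl)
    then have "(w @ [(s, \<not> b), (s, b)] @ u, w @ [] @ u) \<in> ?r"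
      using w(1) pres_app pres_refl by blast
    then have "((w @ [(s, \<not> b)]) @ a # u, []) \<in> ?r"
      using w(2) a by (auto intro: pres_trans)
    moreover have "w @ [(s, \<not> b)] \<in> gwords S" using w(1) s by (auto simp: gwords_def)
    ultimately show ?case by blast
  qed
  then obtain w where w: "w \<in> gwords S" "(w @ u, []) \<in> ?r" by blast
  have "?r `` {w} \<otimes>\<^bsub>?G\<^esub> x = \<one>\<^bsub>?G\<^esub>"
    using presented_group_mult[OF w(1) u(1), of R] u(2) equiv_class_eq[OF equiv_pres_rel w(2)]
    by (simp add: one)
  then show "\<exists>y\<in>carrier ?G. y \<otimes>\<^bsub>?G\<^esub> x = \<one>\<^bsub>?G\<^esub>"
    using w(1) by (auto simp: carr intro!: quotientI)
  fix y assume "y \<in> carrier ?G"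
  then obtain v where v: "v \<in> gwords S" "y = ?r `` {v}"
    by (auto simp: carr elim: quotientE)
  show "x \<otimes>\<^bsub>?G\<^esub> y \<in> carrier ?G"
    using u v by (simp add: presented_group_mult carr app quotientI)
  fix z assume "z \<in> carrier ?G"
  then obtain t where t: "t \<in> gwords S" "z = ?r `` {t}"
    by (auto simp: carr elim: quotientE)
  show "x \<otimes>\<^bsub>?G\<^esub> y \<otimes>\<^bsub>?G\<^esub> z = x \<otimes>\<^bsub>?G\<^esub> (y \<otimes>\<^bsub>?G\<^esub> z)"
    using u v t by (simp add: presented_group_mult app)
qed

section \<open>Coxeter matrices and Artin groups\<close>

definition coxeter_matrix :: "'a set \<Rightarrow> ('a \<Rightarrow> 'a \<Rightarrow> enat) \<Rightarrow> bool" where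
  "coxeter_matrix S m \<longleftrightarrow>
     (\<forall>s\<in>S. \<forall>t\<in>S. m s t = m t s) \<and>
     (\<forall>s\<in>S. m s s = 1) \<and>
     (\<forall>s\<in>S. \<forall>t\<in>S. s \<noteq> t \<longrightarrow> m s t \<ge> 2)"

text \<open>The alternating word \<open>s t s t \<dots>\<close> of length \<open>n\<close>, starting with \<open>s\<close>.\<close>

fun alt_word :: "'a \<Rightarrow> 'a \<Rightarrow> nat \<Rightarrow> 'a gword" where
  "alt_word s t 0 = []"
| "alt_word s t (Suc n) = (s, True) # alt_word t s n"

definition artin_relations :: "'a set \<Rightarrow> ('a \<Rightarrow> 'a \<Rightarrow> enat) \<Rightarrow> ('a gword \<times> 'a gword) set" where
  "artin_relations S m =
     {(alt_word s t k, alt_word t s k) | s t k. s \<in> S \<and> t \<in> S \<and> m s t = enat k}"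

definition artin_group :: "'a set \<Rightarrow> ('a \<Rightarrow> 'a \<Rightarrow> enat) \<Rightarrow> 'a gword set monoid" where
  "artin_group S m = presented_group S (artin_relations S m)"

end

theory Submission
  imports Defs "HOL-Algebra.Elementary_Groups"
begin

text \<open>
  A braid relation of odd length \<open>2j + 1\<close> reads \<open>s w = w t\<close>, where \<open>w\<close> is the alternating word
  \<open>t s t s \<dots>\<close> of length \<open>2j\<close>. Hence \<open>t = c s\<close> with \<open>c = [w\<^sup>-\<^sup>1, s]\<close> in \<open>\<Gamma>\<^sub>2\<close>, and
  \<open>[s, t] = [s, c]\<close> lies in \<open>\<Gamma>\<^sub>3\<close>. If \<open>m\<^sub>s\<^sub>,\<^sub>t = 2\<close> then \<open>[s, t] = 1\<close>. So the generators commute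
  modulo the normal subgroup \<open>\<Gamma>\<^sub>3\<close>, the quotient by \<open>\<Gamma>\<^sub>3\<close> is abelian, and \<open>\<Gamma>\<^sub>2 = \<Gamma>\<^sub>3\<close>. On the other
  hand the exponent sum is a nonzero homomorphism to the integers, so \<open>\<Gamma>\<^sub>1 \<noteq> \<Gamma>\<^sub>2\<close>.
\<close>

section \<open>Commutator subgroups\<close>

definition commutator :: "('a, 'b) monoid_scheme \<Rightarrow> 'a \<Rightarrow> 'a \<Rightarrow> 'a" where
  "commutator G x y = x \<otimes>\<^bsub>G\<^esub> y \<otimes>\<^bsub>G\<^esub> inv\<^bsub>G\<^esub> x \<otimes>\<^bsub>G\<^esub> inv\<^bsub>G\<^esub> y"

lemma commutator_subgroup_eq_generate:
  "commutator_subgroup G H K = generate G {commutator G h k | h k. h \<in> H \<and> k \<in> K}"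
  unfolding commutator_subgroup_def commutator_def
  by (rule arg_cong[where f = "generate G"]) auto

lemma commutator_subgroup_self: "commutator_subgroup G H H = derived G H"
  by (simp add: commutator_subgroup_def derived_def)

lemma commutator_in_commutator_subgroup:
  "x \<in> H \<Longrightarrow> y \<in> K \<Longrightarrow> commutator G x y \<in> commutator_subgroup G H K"
  unfolding commutator_subgroup_eq_generate by (rule generate.incl) blast

context group
begin

lemma inv_mult_cancel:
  assumes "x \<in> carrier G" "y \<in> carrier G"
  shows "x \<otimes> (inv x \<otimes> y) = y" "inv x \<otimes> (x \<otimes> y) = y"
  using assms by (simp_all flip: m_assoc)

text \<open>As rewrite rules these bring a product of letters and inverses to right-nested reduced
  form, so the commutator identities below reduce to comparing normal forms.\<close>

lemmas word_simps = m_assoc inv_mult_group inv_mult_cancel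

lemma commutator_closed [simp, intro]:
  "x \<in> carrier G \<Longrightarrow> y \<in> carrier G \<Longrightarrow> commutator G x y \<in> carrier G"
  by (simp add: commutator_def)

lemma inv_commutator:
  "x \<in> carrier G \<Longrightarrow> y \<in> carrier G \<Longrightarrow> inv (commutator G x y) = commutator G y x"
  by (simp add: commutator_def word_simps)

lemma commutator_one [simp]: "x \<in> carrier G \<Longrightarrow> commutator G x \<one> = \<one>"
  by (simp add: commutator_def)

lemma commutator_commute:
  assumes "x \<in> carrier G" "y \<in> carrier G" "x \<otimes> y = y \<otimes> x"
  shows "commutator G x y = \<one>"
  using assms by (simp add: commutator_def word_simps)

text \<open>The right-hand side uses only commutators with \<open>x\<close> and their conjugates,
  the form in which a normal subgroup absorbs it.\<close>

lemma commutator_mult_right: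
  assumes "x \<in> carrier G" "y \<in> carrier G" "z \<in> carrier G"
  shows "commutator G x (y \<otimes> z) = commutator G x y \<otimes> (y \<otimes> commutator G x z \<otimes> inv y)"
  using assms by (simp add: commutator_def word_simps)

lemma commutator_inv_right:
  assumes "x \<in> carrier G" "y \<in> carrier G"
  shows "commutator G x (inv y) = inv y \<otimes> inv (commutator G x y) \<otimes> inv (inv y)"
  using assms by (simp add: commutator_def word_simps)

lemma commutator_mult_self_right:
  assumes "x \<in> carrier G" "c \<in> carrier G"
  shows "commutator G x (c \<otimes> x) = commutator G x c"
  using assms by (simp add: commutator_def word_simps)

lemma conj_commutator:
  assumes "g \<in> carrier G" "x \<in> carrier G" "y \<in> carrier G"
  shows "g \<otimes> commutator G x y \<otimes> inv g = commutator G (g \<otimes> x \<otimes> inv g) (g \<otimes> y \<otimes> inv g)"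
  using assms by (simp add: commutator_def word_simps)

text \<open>Conjugating a commutator conjugates both entries, so the generating set is itself closed
  under conjugation.\<close>

lemma commutator_subgroup_normal:
  assumes "H \<lhd> G" "K \<lhd> G"
  shows "commutator_subgroup G H K \<lhd> G"
  unfolding commutator_subgroup_eq_generate
proof (rule normal_generateI)
  interpret H: normal H G by fact
  interpret K: normal K G by fact
  show "{commutator G h k | h k. h \<in> H \<and> k \<in> K} \<subseteq> carrier G"
    by auto
  fix x g assume "x \<in> {commutator G h k | h k. h \<in> H \<and> k \<in> K}" and g: "g \<in> carrier G"
  then obtain h k where "x = commutator G h k" "h \<in> H" "k \<in> K" by blast
  then have "g \<otimes> x \<otimes> inv g = commutator G (g \<otimes> h \<otimes> inv g) (g \<otimes> k \<otimes> inv g)"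
    using g by (simp add: conj_commutator)
  then show "g \<otimes> x \<otimes> inv g \<in> {commutator G h k | h k. h \<in> H \<and> k \<in> K}"
    using H.inv_op_closed2[OF g \<open>h \<in> H\<close>] K.inv_op_closed2[OF g \<open>k \<in> K\<close>] by blast
qed

lemma commutator_subgroup_mono:
  "H \<subseteq> H' \<Longrightarrow> K \<subseteq> K' \<Longrightarrow> commutator_subgroup G H K \<subseteq> commutator_subgroup G H' K'"
  unfolding commutator_subgroup_eq_generate by (intro mono_generate) blast

end

context normal
begin

text \<open>For fixed \<open>x\<close>, the elements \<open>y\<close> with
  \<open>commutator G x y\<close> in the normal subgroup \<open>H\<close> are closed under products
  and inverses, by the identities for commutators with a product or an inverse on the right.\<close>

lemma commutator_generate_right:
  assumes "x \<in> carrier G" "A \<subseteq> carrier G" "\<And>a. a \<in> A \<Longrightarrow> commutator G x a \<in> H"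
    and "y \<in> generate G A"
  shows "commutator G x y \<in> H"
  using assms(4)
proof (induction rule: generate.induct)
  case one
  then show ?case using assms(1) by simp
next
  case (incl a)
  then show ?case by (rule assms(3))
next
  case (inv a)
  have a: "a \<in> carrier G" using inv assms(2) by blast
  show ?case
    unfolding commutator_inv_right[OF assms(1) a]
    using a inv assms(3) by (intro inv_op_closed2) auto
next
  case (eng y z)
  have y: "y \<in> carrier G" and z: "z \<in> carrier G"
    using eng generate_in_carrier[OF assms(2)] by auto
  show ?case
    unfolding commutator_mult_right[OF assms(1) y z]
    using eng.IH y by (simp add: subgroup.m_closed[OF subgroup_axioms] inv_op_closed2)
qed

text \<open>This says that the quotient by \<open>H\<close> is abelian, but without forming it: the
  commutator condition is extended from generators to all elements in one argument at a
  time.\<close>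

lemma derived_subset_if_generators_commute:
  assumes "A \<subseteq> carrier G" "generate G A = carrier G"
    and "\<And>a b. a \<in> A \<Longrightarrow> b \<in> A \<Longrightarrow> commutator G a b \<in> H"
  shows "derived G (carrier G) \<subseteq> H"
proof -
  have *: "commutator G a y \<in> H" if "a \<in> A" "y \<in> carrier G" for a y
    by (rule commutator_generate_right[of a A]) (use that assms in auto)
  \<comment> \<open>Inversion swaps the arguments of a commutator, which moves the generator to the
    right, where the extension can be repeated.\<close>
  have **: "commutator G y a \<in> H" if "a \<in> A" "y \<in> carrier G" for a y
    using that assms(1) m_inv_closed[OF *[OF that]] inv_commutator[of a y] by auto
  have "commutator G x y \<in> H" if "x \<in> carrier G" "y \<in> carrier G" for x y
    by (rule commutator_generate_right[of x A]) (use that assms ** in auto)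
  then have "derived_set G (carrier G) \<subseteq> H"
    by (auto simp: commutator_def)
  then show ?thesis
    unfolding derived_def by (rule generate_subgroup_incl[OF _ subgroup_axioms])
qed

end

text \<open>A homomorphism into an abelian group sends the derived subgroup to the derived subgroup
  of its image, which is trivial.\<close>

lemma (in group) derived_neq_carrier_if_hom:
  assumes "comm_group K" "\<phi> \<in> hom G K" "x \<in> carrier G" "\<phi> x \<noteq> \<one>\<^bsub>K\<^esub>"
  shows "derived G (carrier G) \<noteq> carrier G"
proof -
  interpret K: comm_group K by fact
  interpret \<phi>: group_hom G K \<phi>
    using assms(2) by unfold_locales
  have "\<phi> ` derived G (carrier G) = {\<one>\<^bsub>K\<^esub>}"
    using \<phi>.derived_img[of "carrier G"] K.derived_eq_singleton[OF \<phi>.img_is_subgroup[THEN subgroup.subset]]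
    by simp
  then show ?thesis using assms(3,4) by blast
qed

section \<open>Presented groups\<close>

lemma gwords_simps [simp]:
  "[] \<in> gwords S"
  "a # u \<in> gwords S \<longleftrightarrow> fst a \<in> S \<and> u \<in> gwords S"
  "u @ v \<in> gwords S \<longleftrightarrow> u \<in> gwords S \<and> v \<in> gwords S"
  by (cases a; auto simp: gwords_def)+

definition word_class :: "'a set \<Rightarrow> ('a gword \<times> 'a gword) set \<Rightarrow> 'a gword \<Rightarrow> 'a gword set" where
  "word_class S R u = pres_rel S R `` {u}"

lemma carrier_presented_group:
  "carrier (presented_group S R) = word_class S R ` gwords S"
  by (auto simp: presented_group_def word_class_def quotient_def)

lemma word_class_closed [simp]:
  "u \<in> gwords S \<Longrightarrow> word_class S R u \<in> carrier (presented_group S R)"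
  by (simp add: carrier_presented_group)

lemma word_class_append:
  "u \<in> gwords S \<Longrightarrow> v \<in> gwords S \<Longrightarrow>
    word_class S R (u @ v) = word_class S R u \<otimes>\<^bsub>presented_group S R\<^esub> word_class S R v"
  by (simp add: word_class_def presented_group_mult)

lemma word_class_Nil: "word_class S R [] = \<one>\<^bsub>presented_group S R\<^esub>"
  by (simp add: word_class_def presented_group_def)

lemma word_class_eqI: "(u, v) \<in> pres_rel S R \<Longrightarrow> word_class S R u = word_class S R v"
  unfolding word_class_def by (rule equiv_class_eq[OF equiv_pres_rel])

lemma word_class_eqD:
  "word_class S R u = word_class S R v \<Longrightarrow> v \<in> gwords S \<Longrightarrow> (u, v) \<in> pres_rel S R"
  unfolding word_class_def by (rule eq_equiv_class[OF _ equiv_pres_rel])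

lemma word_class_inverse_letter:
  assumes "s \<in> S"
  shows "word_class S R [(s, False)] = inv\<^bsub>presented_group S R\<^esub> word_class S R [(s, True)]"
proof -
  interpret group "presented_group S R" by (rule presented_group_is_group)
  have "word_class S R ([(s, False)] @ [(s, True)]) = \<one>\<^bsub>presented_group S R\<^esub>"
    using word_class_eqI[OF pres_cancel[OF assms, of False R]] by (simp add: word_class_Nil)
  then show ?thesis
    using assms by (intro inv_equality[symmetric]) (simp_all add: word_class_append[symmetric])
qed

text \<open>Positive letters suffice, since a negative letter represents the inverse of a positive
  one.\<close>

lemma generate_presented_group:
  "generate (presented_group S R) ((\<lambda>s. word_class S R [(s, True)]) ` S)
     = carrier (presented_group S R)" (is "generate ?G ?A = _")
proof
  interpret group ?G by (rule presented_group_is_group)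
  show "generate ?G ?A \<subseteq> carrier ?G"
    by (intro generate_incl) auto
  have "word_class S R u \<in> generate ?G ?A" if "u \<in> gwords S" for u
    using that
  proof (induction u)
    case Nil
    then show ?case by (simp add: word_class_Nil generate.one)
  next
    case (Cons a u)
    obtain s b where a: "a = (s, b)" by (cases a)
    have s: "s \<in> S" and u: "u \<in> gwords S" using Cons.prems a by auto
    have "word_class S R [a] \<in> generate ?G ?A"
      using s a by (cases b) (auto simp: word_class_inverse_letter intro: generate.incl generate.inv)
    then have "word_class S R ([a] @ u) \<in> generate ?G ?A"
      using s u a Cons.IH by (subst word_class_append) (auto intro: generate.eng)
    then show ?case by simp
  qed
  then show "carrier ?G \<subseteq> generate ?G ?A"
    by (auto simp: carrier_presented_group)
qed

definition exponent_sum :: "'a gword \<Rightarrow> int" where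
  "exponent_sum u = (\<Sum>(s, b) \<leftarrow> u. if b then 1 else - 1)"

lemma exponent_sum_simps [simp]:
  "exponent_sum [] = 0"
  "exponent_sum ((s, b) # u) = (if b then 1 else - 1) + exponent_sum u"
  "exponent_sum (u @ v) = exponent_sum u + exponent_sum v"
  by (simp_all add: exponent_sum_def)

lemma exponent_sum_pres_rel:
  assumes "\<And>u v. (u, v) \<in> R \<Longrightarrow> exponent_sum u = exponent_sum v" "(u, v) \<in> pres_rel S R"
  shows "exponent_sum u = exponent_sum v"
  using assms(2) by induction (auto simp: assms(1))

lemma exponent_sum_hom:
  assumes "\<And>u v. (u, v) \<in> R \<Longrightarrow> exponent_sum u = exponent_sum v"
  obtains \<phi> where "\<phi> \<in> hom (presented_group S R) integer_group"
    and "\<And>u. u \<in> gwords S \<Longrightarrow> \<phi> (word_class S R u) = exponent_sum u"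
proof
  \<comment> \<open>\<open>inv_into\<close> picks some word representing the class \<open>A\<close>;
    the choice is immaterial because \<open>exponent_sum\<close> is constant on classes.\<close>
  define \<phi> where "\<phi> A = exponent_sum (inv_into (gwords S) (word_class S R) A)" for A
  show \<phi>: "\<phi> (word_class S R u) = exponent_sum u" if "u \<in> gwords S" for u
    unfolding \<phi>_def
    by (rule exponent_sum_pres_rel[OF assms word_class_eqD[OF f_inv_into_f that]])
       (use that in auto)
  show "\<phi> \<in> hom (presented_group S R) integer_group"
    by (rule homI) (auto simp: carrier_presented_group \<phi> simp flip: word_class_append)
qed

section \<open>Artin groups\<close>

lemma alt_word_gwords [simp]: "s \<in> S \<Longrightarrow> t \<in> S \<Longrightarrow> alt_word s t k \<in> gwords S"
  by (induction k arbitrary: s t) auto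

lemma exponent_sum_alt_word: "exponent_sum (alt_word s t k) = int k"
  by (induction s t k rule: alt_word.induct) auto

text \<open>An alternating word of odd length ends in the letter it starts with; this puts an odd
  braid relation in the form \<open>s w = w t\<close>.\<close>

lemma alt_word_odd: "alt_word s t (Suc (2 * j)) = alt_word s t (2 * j) @ [(s, True)]"
  by (induction j) auto

lemma artin_relation_class:
  assumes "s \<in> S" "t \<in> S" "m s t = enat k"
  shows "word_class S (artin_relations S m) (alt_word s t k)
       = word_class S (artin_relations S m) (alt_word t s k)"
  using assms by (intro word_class_eqI pres_rels) (auto simp: artin_relations_def)

theorem proposition2p11:
  fixes S :: "'a set" and m :: "'a \<Rightarrow> 'a \<Rightarrow> enat"
  assumes "S \<noteq> {}"
    and "coxeter_matrix S m"
    and "\<forall>s\<in>S. \<forall>t\<in>S. m s t \<noteq> \<infinity> \<and> (odd (the_enat (m s t)) \<or> m s t = 2)"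
  shows "lower_central_stops_at (artin_group S m) 2"
proof -
  define R where "R = artin_relations S m"
  define G where "G = presented_group S R"
  define x where "x s = word_class S R [(s, True)]" for s
  interpret group G unfolding G_def by (rule presented_group_is_group)
  have x_closed [simp]: "x s \<in> carrier G" if "s \<in> S" for s
    using that by (simp add: x_def G_def)

  have \<Gamma>2: "lower_central G 2 = derived G (carrier G)"
    by (simp add: numeral_2_eq_2 commutator_subgroup_self)
  \<comment> \<open>This is \<Gamma>\<open>\<^sub>3\<close>, indexed as \<open>2 + 1\<close> to
    match \<open>k + 1\<close> in the definition of stopping.\<close>
  define N where "N = lower_central G (2 + 1)"
  have N: "N = commutator_subgroup G (carrier G) (derived G (carrier G))"
    by (simp add: N_def numeral_2_eq_2 commutator_subgroup_self)

  have "N \<lhd> G"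
    unfolding N by (intro commutator_subgroup_normal normal_self derived_self_is_normal)
  then interpret N: normal N G .

  have "commutator G (x s) (x t) \<in> N" if st: "s \<in> S" "t \<in> S" for s t
  proof -
    \<comment> \<open>The diagonal \<open>s = t\<close> falls under the odd case, with
      \<open>k = 1\<close>.\<close>
    obtain k where k: "m s t = enat k" "odd k \<or> k = 2"
      using assms(3) st by (cases "m s t") (fastforce simp: numeral_eq_enat)+
    have rel: "word_class S R (alt_word s t k) = word_class S R (alt_word t s k)"
      unfolding R_def using st k(1) by (rule artin_relation_class)
    from k(2) show ?thesis
    proof
      assume "odd k"
      then obtain j where j: "k = Suc (2 * j)" by (metis oddE Suc_eq_plus1)
      define w where "w = word_class S R (alt_word t s (2 * j))"
      have w: "w \<in> carrier G" using st by (simp add: w_def G_def)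
      \<comment> \<open>The left word is the defining unfolding of \<open>alt_word s t k\<close>;
        the right one splits off the last letter of \<open>alt_word t s k\<close>.\<close>
      have "word_class S R ([(s, True)] @ alt_word t s (2 * j))
          = word_class S R (alt_word t s (2 * j) @ [(t, True)])"
        using rel unfolding j alt_word_odd[of t s] by simp
      then have "x s \<otimes>\<^bsub>G\<^esub> w = w \<otimes>\<^bsub>G\<^esub> x t"
        using st by (simp only: word_class_append gwords_simps alt_word_gwords x_def w_def G_def
          fst_conv simp_thms)
      then have "inv\<^bsub>G\<^esub> w \<otimes>\<^bsub>G\<^esub> (x s \<otimes>\<^bsub>G\<^esub> w) = x t"
        using w st by (simp add: inv_mult_cancel)
      then have "x t = commutator G (inv\<^bsub>G\<^esub> w) (x s) \<otimes>\<^bsub>G\<^esub> x s"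
        using w st by (simp add: commutator_def word_simps)
      then have "commutator G (x s) (x t)
          = commutator G (x s) (commutator G (inv\<^bsub>G\<^esub> w) (x s))"
        using w st by (simp add: commutator_mult_self_right)
      then show ?thesis
        unfolding N commutator_subgroup_self[symmetric] using w st
        by (auto intro!: commutator_in_commutator_subgroup)
    next
      assume "k = 2"
      then have "word_class S R ([(s, True)] @ [(t, True)])
          = word_class S R ([(t, True)] @ [(s, True)])"
        using rel by (simp add: numeral_2_eq_2)
      then have "x s \<otimes>\<^bsub>G\<^esub> x t = x t \<otimes>\<^bsub>G\<^esub> x s"
        using st by (simp only: word_class_append gwords_simps x_def G_def fst_conv simp_thms)
      then show ?thesis using st by (simp add: commutator_commute)
    qed
  qed
  moreover have "generate G (x ` S) = carrier G"
    unfolding x_def G_def by (rule generate_presented_group)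
  ultimately have "lower_central G 2 \<subseteq> N"
    unfolding \<Gamma>2 by (intro N.derived_subset_if_generators_commute[of "x ` S"]) auto
  \<comment> \<open>Both sides are commutator subgroups with \<open>carrier G\<close> on the left,
    so monotonicity in the right argument suffices.\<close>
  moreover have "N \<subseteq> lower_central G 2"
    unfolding \<Gamma>2 N commutator_subgroup_self[of G "carrier G", symmetric]
    by (intro commutator_subgroup_mono)
       (simp_all add: commutator_subgroup_self derived_in_carrier)
  ultimately have stop: "lower_central G 2 = lower_central G (2 + 1)" unfolding N_def by blast

  \<comment> \<open>The two sides of a braid relation are positive words of the same length.\<close>
  have "exponent_sum u = exponent_sum v" if "(u, v) \<in> R" for u v
    using that by (auto simp: R_def artin_relations_def exponent_sum_alt_word)
  then obtain \<phi> where \<phi>: "\<phi> \<in> hom G integer_group"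
    and "\<And>u. u \<in> gwords S \<Longrightarrow> \<phi> (word_class S R u) = exponent_sum u"
    unfolding G_def using exponent_sum_hom by metis
  then have "\<phi> (x s) = 1" if "s \<in> S" for s
    using that by (simp add: x_def)
  \<comment> \<open>A generator exists as \<open>S\<close> is nonempty, and its value 1 differs from
    0, the neutral element of \<open>integer_group\<close>.\<close>
  moreover obtain s where "s \<in> S" using assms(1) by blast
  ultimately have "lower_central G 1 \<noteq> lower_central G 2"
    using derived_neq_carrier_if_hom[OF abelian_integer_group \<phi> x_closed[of s]]
    unfolding \<Gamma>2 by auto
  then have "2 \<le> i" if "1 \<le> i" "lower_central G i = lower_central G (i + 1)" for i
    using that by (cases "i = 1") (auto simp: numeral_2_eq_2)
  with stop show ?thesis
    by (simp add: lower_central_stops_at_def artin_group_def G_def R_def)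
qed

end
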